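(* Let $G$ be both a groupoid and a topological space (no compatibility assumed) with Hausdorff unit space $G^0$, let $Y$ be a unital $1$-cancellative semigroup, and let $A\subseteq{}_Y\mathcal{O}(G)$ be a semigroup whose product is given by $ab(gh)=a(g)b(h)$ whenever $\mathrm{dom}(a)$ or $\mathrm{dom}(b)$ is a bisection. Let $Z,S,C,N,M\subseteq A$ be the subsets defined in the context. If $\mathrm{dom}[Z]=\{\mathrm{dom}(z):z\in Z\}$ is $T_0$, then $$M\subseteq\mathsf{N}(Z)\subseteq N,\qquad\text{where }\mathsf{N}(Z)=\{a\in A:aZ=Za\}.$$
   Context: For a groupoid $G$: $\mathsf{s}(g)=g^{-1}g$, $\mathsf{r}(g)=gg^{-1}$; $G^0$ is the set of units; $gh$ is defined iff $\mathsf{s}(g)=\mathsf{r}(h)$; for $X,X'\subseteq G$, $XX'=\{xx':x\in X,x'\in X',\mathsf{s}(x)=\mathsf{r}(x')\}$ and $X^{-1}=\{x^{-1}:x\in X\}$. $\mathcal{O}(G)$ is the topology of $G$. A bisection is $B\subseteq G$ with $BB^{-1}\cup B^{-1}B\subseteq G^0$. $G^{\mathrm{iso}}=\{g\in G:\mathsf{s}(g)=\mathsf{r}(g)\}$; an isosection is $I\subseteq G$ with $II^{-1}\cup I^{-1}I\subseteq G^{\mathrm{iso}}$. A unital semigroup $Y$ is $1$-cancellative if for all $x,y\in Y$: $xy=x\Leftrightarrow y=1\Leftrightarrow yx=x$. $\mathsf{Z}(Y)$ is the centre of $Y$. For a family $\mathcal{X}$ of subsets of $G$, ${}_Y\mathcal{X}$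 is the set of partial functions $a$ from $G$ to $Y$ with domain $\mathrm{dom}(a)\in\mathcal{X}$; $\mathrm{ran}(a)$ is the range. The assumption on $A$: it is a set of partial functions with open domains carrying an associative product such that, whenever $\mathrm{dom}(a)$ or $\mathrm{dom}(b)$ is a bisection, $ab$ is the function with domain $\mathrm{dom}(a)\mathrm{dom}(b)$ given by $ab(gh)=a(g)b(h)$ for $g\in\mathrm{dom}(a)$, $h\in\mathrm{dom}(b)$, $\mathsf{s}(g)=\mathsf{r}(h)$. (Nothing but associativity is assumed about other products.) Subsets of $A$: $Z=\{a\in A:\mathrm{dom}(a)\subseteq G^0,\ \mathrm{ran}(a)\subseteq\mathsf{Z}(Y)\}$; $S=\{a\in A:\mathrm{dom}(a)\text{ is a bisection}\}$; $C=\{a\in A:\mathrm{dom}(a)\subseteq G^{\mathrm{iso}}\}$; $N=\{a\in A:\mathrm{dom}(a)\text{ is an isosection}\}$; $M=\{n\in N:\exists s,t\in S\ (stn=n=nts,\ tn,nt\in C\text{ and }st,ts\in Z)\}$. $\mathrm{dom}[Z]$ is $T_0$ if for all distinct $g,h\in G^0$ there is $P\in\mathrm{dom}[Z]$ containing exactly one of $g,h$. *)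

theory Defs
  imports "HOL-Analysis.Analysis" "HOL-Algebra.Congruence"
begin

text \<open>
  The product is a total HOL function; \<open>g \<cdot> h\<close> is meaningful only when \<open>src g = rng h\<close>, and
  neither the axioms nor the later definitions look at its other values.
\<close>

record 'g groupoid = "'g partial_object" +
  gmult :: "'g \<Rightarrow> 'g \<Rightarrow> 'g" (infixl "\<cdot>\<index>" 70)
  ginv :: "'g \<Rightarrow> 'g"

definition src :: "('g, 'm) groupoid_scheme \<Rightarrow> 'g \<Rightarrow> 'g" where
  "src G g = ginv G g \<cdot>\<^bsub>G\<^esub> g"

definition rng :: "('g, 'm) groupoid_scheme \<Rightarrow> 'g \<Rightarrow> 'g" where
  "rng G g = g \<cdot>\<^bsub>G\<^esub> ginv G g"

text \<open>
  A small category in which all arrows are invertible, with each object identified with its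
  identity arrow.
\<close>

locale groupoid =
  fixes G (structure)
  assumes inv_closed: "g \<in> carrier G \<Longrightarrow> ginv G g \<in> carrier G"
    and src_inv: "g \<in> carrier G \<Longrightarrow> src G (ginv G g) = rng G g"
    and rng_inv: "g \<in> carrier G \<Longrightarrow> rng G (ginv G g) = src G g"
    and mult_closed: "\<lbrakk>g \<in> carrier G; h \<in> carrier G; src G g = rng G h\<rbrakk> \<Longrightarrow> g \<cdot> h \<in> carrier G"
    and src_mult: "\<lbrakk>g \<in> carrier G; h \<in> carrier G; src G g = rng G h\<rbrakk> \<Longrightarrow> src G (g \<cdot> h) = src G h"
    and rng_mult: "\<lbrakk>g \<in> carrier G; h \<in> carrier G; src G g = rng G h\<rbrakk> \<Longrightarrow> rng G (g \<cdot> h) = rng G g"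
    and assoc: "\<lbrakk>g \<in> carrier G; h \<in> carrier G; k \<in> carrier G; src G g = rng G h; src G h = rng G k\<rbrakk>
      \<Longrightarrow> (g \<cdot> h) \<cdot> k = g \<cdot> (h \<cdot> k)"
    and rng_unit: "g \<in> carrier G \<Longrightarrow> rng G g \<cdot> g = g"
    and src_unit: "g \<in> carrier G \<Longrightarrow> g \<cdot> src G g = g"

definition gunits :: "('g, 'm) groupoid_scheme \<Rightarrow> 'g set" where
  "gunits G = src G ` carrier G"

definition iso :: "('g, 'm) groupoid_scheme \<Rightarrow> 'g set" where
  "iso G = {g \<in> carrier G. src G g = rng G g}"

definition set_prod :: "('g, 'm) groupoid_scheme \<Rightarrow> 'g set \<Rightarrow> 'g set \<Rightarrow> 'g set" where
  "set_prod G X X' = {x \<cdot>\<^bsub>G\<^esub> x' | x x'. x \<in> X \<and> x' \<in> X' \<and> src G x = rng G x'}"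

definition bisection :: "('g, 'm) groupoid_scheme \<Rightarrow> 'g set \<Rightarrow> bool" where
  "bisection G B \<longleftrightarrow> B \<subseteq> carrier G \<and>
     set_prod G B (ginv G ` B) \<union> set_prod G (ginv G ` B) B \<subseteq> gunits G"

definition isosection :: "('g, 'm) groupoid_scheme \<Rightarrow> 'g set \<Rightarrow> bool" where
  "isosection G I \<longleftrightarrow> I \<subseteq> carrier G \<and>
     set_prod G I (ginv G ` I) \<union> set_prod G (ginv G ` I) I \<subseteq> iso G"

definition one_cancellative :: "'y::monoid_mult itself \<Rightarrow> bool" where
  "one_cancellative _ \<longleftrightarrow>
     (\<forall>x y :: 'y. (x * y = x \<longleftrightarrow> y = 1) \<and> (y = 1 \<longleftrightarrow> y * x = x))"

definition centre :: "'y::monoid_mult set" where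
  "centre = {x. \<forall>y. x * y = y * x}"

definition partial_functions :: "'g set set \<Rightarrow> ('g \<rightharpoonup> 'y) set" where
  "partial_functions \<X> = {a. dom a \<in> \<X>}"

definition semigroup_on :: "'a set \<Rightarrow> ('a \<Rightarrow> 'a \<Rightarrow> 'a) \<Rightarrow> bool" where
  "semigroup_on A f \<longleftrightarrow>
     (\<forall>a\<in>A. \<forall>b\<in>A. f a b \<in> A) \<and> (\<forall>a\<in>A. \<forall>b\<in>A. \<forall>c\<in>A. f (f a b) c = f a (f b c))"

definition bisection_product ::
  "('g, 'm) groupoid_scheme \<Rightarrow> ('g \<rightharpoonup> 'y::monoid_mult) set \<Rightarrow>
    (('g \<rightharpoonup> 'y) \<Rightarrow> ('g \<rightharpoonup> 'y) \<Rightarrow> ('g \<rightharpoonup> 'y)) \<Rightarrow> bool" where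
  "bisection_product G A f \<longleftrightarrow>
     (\<forall>a\<in>A. \<forall>b\<in>A. bisection G (dom a) \<or> bisection G (dom b) \<longrightarrow>
        dom (f a b) = set_prod G (dom a) (dom b) \<and>
        (\<forall>g\<in>dom a. \<forall>h\<in>dom b. src G g = rng G h \<longrightarrow>
           f a b (g \<cdot>\<^bsub>G\<^esub> h) = Some (the (a g) * the (b h))))"

definition Z_of :: "('g, 'm) groupoid_scheme \<Rightarrow> ('g \<rightharpoonup> 'y::monoid_mult) set \<Rightarrow> ('g \<rightharpoonup> 'y) set" where
  "Z_of G A = {a \<in> A. dom a \<subseteq> gunits G \<and> ran a \<subseteq> centre}"

definition S_of :: "('g, 'm) groupoid_scheme \<Rightarrow> ('g \<rightharpoonup> 'y) set \<Rightarrow> ('g \<rightharpoonup> 'y) set" where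
  "S_of G A = {a \<in> A. bisection G (dom a)}"

definition C_of :: "('g, 'm) groupoid_scheme \<Rightarrow> ('g \<rightharpoonup> 'y) set \<Rightarrow> ('g \<rightharpoonup> 'y) set" where
  "C_of G A = {a \<in> A. dom a \<subseteq> iso G}"

definition N_of :: "('g, 'm) groupoid_scheme \<Rightarrow> ('g \<rightharpoonup> 'y) set \<Rightarrow> ('g \<rightharpoonup> 'y) set" where
  "N_of G A = {a \<in> A. isosection G (dom a)}"

definition M_of ::
  "('g, 'm) groupoid_scheme \<Rightarrow> ('g \<rightharpoonup> 'y::monoid_mult) set \<Rightarrow>
    (('g \<rightharpoonup> 'y) \<Rightarrow> ('g \<rightharpoonup> 'y) \<Rightarrow> ('g \<rightharpoonup> 'y)) \<Rightarrow> ('g \<rightharpoonup> 'y) set" where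
  "M_of G A f = {n \<in> N_of G A. \<exists>s\<in>S_of G A. \<exists>t\<in>S_of G A.
     f (f s t) n = n \<and> n = f (f n t) s \<and>
     f t n \<in> C_of G A \<and> f n t \<in> C_of G A \<and> f s t \<in> Z_of G A \<and> f t s \<in> Z_of G A}"

definition normalisers :: "'a set \<Rightarrow> ('a \<Rightarrow> 'a \<Rightarrow> 'a) \<Rightarrow> 'a set \<Rightarrow> 'a set" where
  "normalisers A f W = {a \<in> A. (\<lambda>w. f a w) ` W = (\<lambda>w. f w a) ` W}"

definition T0_on :: "'g set \<Rightarrow> 'g set set \<Rightarrow> bool" where
  "T0_on X \<P> \<longleftrightarrow> (\<forall>g\<in>X. \<forall>h\<in>X. g \<noteq> h \<longrightarrow> (\<exists>P\<in>\<P>. (g \<in> P) \<noteq> (h \<in> P)))"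

end

theory Submission
  imports Defs
begin

text \<open>
  Multiplying by an element \<open>z\<close> of \<open>Z\<close> on the right (left) restricts a function to those arrows
  whose source (range) lies in \<open>dom z\<close>, and scales it there by the central values of \<open>z\<close>. Two
  arguments follow from this.

  Let \<open>n \<in> M\<close>, witnessed by \<open>s\<close> and \<open>t\<close>. On isotropy arrows source and range agree, so elements of
  \<open>C\<close> commute with elements of \<open>Z\<close>. As \<open>tn \<in> C\<close>,
  \<open>nz = s(tn)z = sz(tn) = (szt)n\<close>. Inserting \<open>z\<close> between \<open>s\<close> and \<open>t\<close> only restricts \<open>st\<close> and scales
  it by central values, so \<open>szt\<close> lies in \<open>Z\<close> together with \<open>st\<close>. Hence \<open>nZ \<subseteq> Zn\<close>, and
  \<open>zn = z(nt)s = n(tzs)\<close> gives the reverse inclusion.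

  Let \<open>aZ = Za\<close> and suppose that two arrows \<open>g, h\<close> of \<open>dom a\<close> have the same source. For \<open>z \<in> Z\<close> write
  \<open>za = aw\<close>: membership of an arrow of \<open>dom a\<close> in the domain of this product is decided by its range
  on one side and by its source on the other. So the ranges of \<open>g\<close> and \<open>h\<close> belong to the same sets
  in \<open>dom[Z]\<close>, and are equal by \<open>T\<^sub>0\<close>. Exchanging source and range completes the proof that
  \<open>dom a\<close> is an isosection.
\<close>

section \<open>Units and isosections of a groupoid\<close>

context groupoid
begin

lemma gunits_carrier: "u \<in> gunits G \<Longrightarrow> u \<in> carrier G"
  unfolding gunits_def
  using inv_closed mult_closed src_inv by (metis (no_types, lifting) imageE src_def)

lemma src_gunit:
  assumes "u \<in> gunits G" shows "src G u = u"
proof -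
  obtain g where g: "g \<in> carrier G" "u = src G g"
    using assms by (auto simp: gunits_def)
  have "src G (ginv G g \<cdot> g) = src G g"
    using g by (intro src_mult inv_closed src_inv)
  then show ?thesis using g by (simp add: src_def)
qed

lemma rng_gunit:
  assumes "u \<in> gunits G" shows "rng G u = u"
proof -
  obtain g where g: "g \<in> carrier G" "u = src G g"
    using assms by (auto simp: gunits_def)
  have "rng G (ginv G g \<cdot> g) = src G g"
    using g rng_mult[of "ginv G g" g] by (simp add: inv_closed src_inv rng_inv)
  then show ?thesis using g by (simp add: src_def)
qed

lemma src_in_gunits: "g \<in> carrier G \<Longrightarrow> src G g \<in> gunits G"
  by (simp add: gunits_def)

lemma rng_in_gunits: "g \<in> carrier G \<Longrightarrow> rng G g \<in> gunits G"
  by (metis gunits_def image_eqI inv_closed src_inv)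

lemma bisection_if_subset_gunits:
  assumes "B \<subseteq> gunits G" shows "bisection G B"
proof -
  have "x \<cdot> ginv G y \<in> gunits G"
    if "x \<in> B" "y \<in> B" "src G x = rng G (ginv G y)" for x y
  proof -
    have "x = y"
      using that assms by (metis gunits_carrier rng_inv src_gunit subsetD)
    then show ?thesis
      using that assms rng_in_gunits[of x] gunits_carrier by (auto simp: rng_def)
  qed
  moreover have "ginv G x \<cdot> y \<in> gunits G"
    if "x \<in> B" "y \<in> B" "src G (ginv G x) = rng G y" for x y
  proof -
    have "x = y"
      using that assms by (metis gunits_carrier src_inv rng_gunit subsetD)
    then show ?thesis
      using that assms src_in_gunits[of x] gunits_carrier by (auto simp: src_def)
  qed
  ultimately show ?thesis
    using assms gunits_carrier unfolding bisection_def set_prod_def by auto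
qed

text \<open>
  The product \<open>gh\<^sup>-\<^sup>1\<close> is defined exactly when the sources of \<open>g\<close> and \<open>h\<close> agree, and its source and
  range are then the ranges of \<open>h\<close> and \<open>g\<close>; dually for \<open>g\<^sup>-\<^sup>1h\<close>.
\<close>

lemma isosectionI:
  assumes "I \<subseteq> carrier G"
    and rng_eq: "\<And>g h. \<lbrakk>g \<in> I; h \<in> I; src G g = src G h\<rbrakk> \<Longrightarrow> rng G g = rng G h"
    and src_eq: "\<And>g h. \<lbrakk>g \<in> I; h \<in> I; rng G g = rng G h\<rbrakk> \<Longrightarrow> src G g = src G h"
  shows "isosection G I"
proof -
  have "x \<cdot> ginv G y \<in> iso G" if "x \<in> I" "y \<in> I" "src G x = rng G (ginv G y)" for x y
  proof -
    have "x \<in> carrier G" "y \<in> carrier G" using that assms(1) by auto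
    then show ?thesis
      using that rng_eq[of x y]
      by (simp add: iso_def mult_closed src_mult rng_mult inv_closed src_inv rng_inv)
  qed
  moreover have "ginv G x \<cdot> y \<in> iso G" if "x \<in> I" "y \<in> I" "src G (ginv G x) = rng G y" for x y
  proof -
    have "x \<in> carrier G" "y \<in> carrier G" using that assms(1) by auto
    then show ?thesis
      using that src_eq[of x y]
      by (simp add: iso_def mult_closed src_mult rng_mult inv_closed src_inv rng_inv)
  qed
  ultimately show ?thesis
    using assms(1) unfolding isosection_def set_prod_def by auto
qed

lemma set_prod_gunits_right:
  assumes "X \<subseteq> carrier G" "U \<subseteq> gunits G"
  shows "set_prod G X U = {g \<in> X. src G g \<in> U}"
proof (intro Set.set_eqI iffI)
  fix k assume "k \<in> set_prod G X U"
  then obtain x u where k: "k = x \<cdot> u" "x \<in> X" "u \<in> U" "src G x = rng G u"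
    by (auto simp: set_prod_def)
  then have "u = src G x" using assms rng_gunit by auto
  then show "k \<in> {g \<in> X. src G g \<in> U}" using k assms src_unit by auto
next
  fix k assume "k \<in> {g \<in> X. src G g \<in> U}"
  moreover from this have "k \<cdot> src G k = k" "src G k = rng G (src G k)"
    using assms src_unit rng_gunit by auto
  ultimately show "k \<in> set_prod G X U" unfolding set_prod_def by force
qed

lemma set_prod_gunits_left:
  assumes "X \<subseteq> carrier G" "U \<subseteq> gunits G"
  shows "set_prod G U X = {g \<in> X. rng G g \<in> U}"
proof (intro Set.set_eqI iffI)
  fix k assume "k \<in> set_prod G U X"
  then obtain x u where k: "k = u \<cdot> x" "x \<in> X" "u \<in> U" "src G u = rng G x"
    by (auto simp: set_prod_def)
  then have "u = rng G x" using assms src_gunit by auto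
  then show "k \<in> {g \<in> X. rng G g \<in> U}" using k assms rng_unit by auto
next
  fix k assume "k \<in> {g \<in> X. rng G g \<in> U}"
  moreover from this have "rng G k \<cdot> k = k" "src G (rng G k) = rng G k"
    using assms rng_unit src_gunit by auto
  ultimately show "k \<in> set_prod G U X" unfolding set_prod_def by force
qed

end

section \<open>Products with central functions on the unit space\<close>

locale bisection_semigroup = groupoid G
  for G :: "('g, 'm) groupoid_scheme" (structure) +
  fixes A :: "('g \<rightharpoonup> 'y::monoid_mult) set"
    and mul :: "('g \<rightharpoonup> 'y) \<Rightarrow> ('g \<rightharpoonup> 'y) \<Rightarrow> ('g \<rightharpoonup> 'y)" (infixl "\<star>" 70)
  assumes dom_carrier: "a \<in> A \<Longrightarrow> dom a \<subseteq> carrier G"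
    and semigroup: "semigroup_on A mul"
    and product: "bisection_product G A mul"
begin

abbreviation "Z \<equiv> Z_of G A"

lemma prod_closed: "\<lbrakk>a \<in> A; b \<in> A\<rbrakk> \<Longrightarrow> a \<star> b \<in> A"
  using semigroup by (simp add: semigroup_on_def)

lemma prod_assoc: "\<lbrakk>a \<in> A; b \<in> A; c \<in> A\<rbrakk> \<Longrightarrow> (a \<star> b) \<star> c = a \<star> (b \<star> c)"
  using semigroup by (simp add: semigroup_on_def)

lemma Z_in_A: "z \<in> Z \<Longrightarrow> z \<in> A"
  by (simp add: Z_of_def)

lemma Z_dom: "z \<in> Z \<Longrightarrow> dom z \<subseteq> gunits G"
  by (simp add: Z_of_def)

lemma Z_central: "\<lbrakk>z \<in> Z; u \<in> dom z\<rbrakk> \<Longrightarrow> the (z u) * y = y * the (z u)"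
  unfolding Z_of_def centre_def by (auto simp: ran_def subset_iff)

lemma Z_bisection: "z \<in> Z \<Longrightarrow> bisection G (dom z)"
  by (intro bisection_if_subset_gunits Z_dom)

lemma dom_prod:
  "\<lbrakk>a \<in> A; b \<in> A; bisection G (dom a) \<or> bisection G (dom b)\<rbrakk>
    \<Longrightarrow> dom (a \<star> b) = set_prod G (dom a) (dom b)"
  using product unfolding bisection_product_def by blast

lemma prod_apply:
  "\<lbrakk>a \<in> A; b \<in> A; bisection G (dom a) \<or> bisection G (dom b);
    g \<in> dom a; h \<in> dom b; src G g = rng G h\<rbrakk>
    \<Longrightarrow> (a \<star> b) (g \<cdot> h) = Some (the (a g) * the (b h))"
  using product unfolding bisection_product_def by blast

lemma dom_prod_Z_right:
  assumes "a \<in> A" "z \<in> Z"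
  shows "dom (a \<star> z) = {g \<in> dom a. src G g \<in> dom z}"
  using assms dom_prod[of a z] Z_bisection Z_in_A set_prod_gunits_right dom_carrier Z_dom by simp

lemma dom_prod_Z_left:
  assumes "a \<in> A" "z \<in> Z"
  shows "dom (z \<star> a) = {g \<in> dom a. rng G g \<in> dom z}"
  using assms dom_prod[of z a] Z_bisection Z_in_A set_prod_gunits_left dom_carrier Z_dom by simp

lemma prod_Z_right_apply:
  assumes "a \<in> A" "z \<in> Z" "g \<in> dom a" "src G g \<in> dom z"
  shows "(a \<star> z) g = Some (the (a g) * the (z (src G g)))"
proof -
  have g: "g \<in> carrier G" using assms dom_carrier by blast
  then have "src G g = rng G (src G g)" by (simp add: rng_gunit src_in_gunits)
  from prod_apply[OF \<open>a \<in> A\<close> Z_in_A[OF \<open>z \<in> Z\<close>] _ assms(3,4) this] show ?thesis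
    using Z_bisection[OF \<open>z \<in> Z\<close>] src_unit[OF g] by simp
qed

lemma prod_Z_left_apply:
  assumes "a \<in> A" "z \<in> Z" "g \<in> dom a" "rng G g \<in> dom z"
  shows "(z \<star> a) g = Some (the (z (rng G g)) * the (a g))"
proof -
  have g: "g \<in> carrier G" using assms dom_carrier by blast
  then have "src G (rng G g) = rng G g" by (simp add: src_gunit rng_in_gunits)
  from prod_apply[OF Z_in_A[OF \<open>z \<in> Z\<close>] \<open>a \<in> A\<close> _ assms(4,3) this] show ?thesis
    using Z_bisection[OF \<open>z \<in> Z\<close>] rng_unit[OF g] by simp
qed

text \<open>
  Restricting by source or by range is the same thing on isotropy arrows, and the scaling factors
  are central.
\<close>

lemma C_commutes_Z:
  assumes "c \<in> C_of G A" "z \<in> Z"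
  shows "c \<star> z = z \<star> c"
proof (rule ext)
  fix g
  have c: "c \<in> A" and iso: "\<And>h. h \<in> dom c \<Longrightarrow> src G h = rng G h"
    using assms(1) by (auto simp: C_of_def iso_def)
  show "(c \<star> z) g = (z \<star> c) g"
  proof (cases "g \<in> dom c \<and> src G g \<in> dom z")
    case True
    then show ?thesis
      using prod_Z_right_apply[OF c assms(2)] prod_Z_left_apply[OF c assms(2)]
        Z_central[OF assms(2)] iso[of g] by auto
  next
    case False
    then have "g \<notin> dom (c \<star> z)" "g \<notin> dom (z \<star> c)"
      using c assms(2) iso[of g] by (auto simp: dom_prod_Z_right dom_prod_Z_left)
    then show ?thesis by (simp add: domIff)
  qed
qed

section \<open>Elements of \<open>M\<close> as normalisers\<close>

text \<open>
  At a product \<open>gh\<close> the function \<open>szt\<close> takes the value \<open>s(g)z(u)t(h) = s(g)t(h)z(u)\<close>, with \<open>u\<close> the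
  source of \<open>g\<close>. So its domain shrinks that of \<open>st\<close>, and its values are central whenever those of
  \<open>st\<close> are.
\<close>

lemma sandwich_in_Z:
  assumes "s \<in> S_of G A" "t \<in> S_of G A" "s \<star> t \<in> Z" "z \<in> Z"
  shows "s \<star> z \<star> t \<in> Z"
proof -
  have s: "s \<in> A" and t: "t \<in> A" and bt: "bisection G (dom t)" and sz: "s \<star> z \<in> A"
    using assms by (auto simp: S_of_def Z_in_A prod_closed)
  have "k \<in> gunits G \<and> the ((s \<star> z \<star> t) k) \<in> centre" if k: "k \<in> dom (s \<star> z \<star> t)" for k
  proof -
    obtain g h where gh: "k = g \<cdot> h" "g \<in> dom (s \<star> z)" "h \<in> dom t" "src G g = rng G h"
      using k dom_prod[of "s \<star> z" t] sz t bt by (auto simp: set_prod_def)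
    then have g: "g \<in> dom s" "src G g \<in> dom z"
      using dom_prod_Z_right[OF s assms(4)] by auto
    have st: "(s \<star> t) k = Some (the (s g) * the (t h))"
      using prod_apply[of s t g h] s t bt g gh by simp
    let ?c = "the (s g) * the (t h)" and ?w = "the (z (src G g))"
    have c_central: "?c * y = y * ?c" for y
      using Z_central[OF assms(3), of k y] st by (simp add: domIff)
    have "(s \<star> z \<star> t) k = Some (the (s g) * ?w * the (t h))"
      using prod_apply[of "s \<star> z" t g h] sz t bt gh prod_Z_right_apply[OF s assms(4) g] by simp
    also have "the (s g) * ?w * the (t h) = ?c * ?w"
      by (metis mult.assoc Z_central[OF assms(4) g(2)])
    finally have val: "(s \<star> z \<star> t) k = Some (?c * ?w)" .
    have "?c * ?w * y = y * (?c * ?w)" for y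
      using c_central Z_central[OF assms(4) g(2)] by (metis mult.assoc)
    then show ?thesis
      using val st Z_dom[OF assms(3)] by (auto simp: centre_def)
  qed
  then show ?thesis
    using prod_closed[OF sz t] unfolding Z_of_def by (fastforce simp: ran_def)
qed

lemma M_subset_normalisers: "M_of G A mul \<subseteq> normalisers A mul Z"
proof
  fix n assume "n \<in> M_of G A mul"
  then obtain s t where st: "s \<in> S_of G A" "t \<in> S_of G A"
    and n_left: "s \<star> t \<star> n = n" and n_right: "n = n \<star> t \<star> s"
    and C: "t \<star> n \<in> C_of G A" "n \<star> t \<in> C_of G A"
    and Z: "s \<star> t \<in> Z" "t \<star> s \<in> Z"
    and "n \<in> N_of G A"
    unfolding M_of_def by blast
  then have A: "s \<in> A" "t \<in> A" "n \<in> A" by (auto simp: S_of_def N_of_def)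
  have right_to_left: "n \<star> z = (s \<star> z \<star> t) \<star> n" if z: "z \<in> Z" for z
  proof -
    have "n \<star> z = (s \<star> t \<star> n) \<star> z" using n_left by simp
    also have "\<dots> = s \<star> ((t \<star> n) \<star> z)"
      using A Z_in_A[OF z] by (simp add: prod_assoc prod_closed)
    also have "\<dots> = s \<star> (z \<star> (t \<star> n))" using C_commutes_Z C z by simp
    also have "\<dots> = (s \<star> z \<star> t) \<star> n" using A Z_in_A[OF z] by (simp add: prod_assoc prod_closed)
    finally show ?thesis .
  qed
  have left_to_right: "z \<star> n = n \<star> (t \<star> z \<star> s)" if z: "z \<in> Z" for z
  proof -
    have "z \<star> n = z \<star> (n \<star> t \<star> s)" using n_right by simp
    also have "\<dots> = (z \<star> (n \<star> t)) \<star> s"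
      using A Z_in_A[OF z] by (simp add: prod_assoc prod_closed)
    also have "\<dots> = ((n \<star> t) \<star> z) \<star> s" using C_commutes_Z C z by simp
    also have "\<dots> = n \<star> (t \<star> z \<star> s)" using A Z_in_A[OF z] by (simp add: prod_assoc prod_closed)
    finally show ?thesis .
  qed
  have "(\<lambda>w. n \<star> w) ` Z = (\<lambda>w. w \<star> n) ` Z"
  proof
    show "(\<lambda>w. n \<star> w) ` Z \<subseteq> (\<lambda>w. w \<star> n) ` Z"
      using sandwich_in_Z[OF st Z(1)] by (intro image_subsetI) (simp add: right_to_left)
    show "(\<lambda>w. w \<star> n) ` Z \<subseteq> (\<lambda>w. n \<star> w) ` Z"
      using sandwich_in_Z[OF st(2,1) Z(2)] by (intro image_subsetI) (simp add: left_to_right)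
  qed
  then show "n \<in> normalisers A mul Z" using A by (simp add: normalisers_def)
qed

section \<open>Supports of normalisers\<close>

lemma normaliser_isosection:
  assumes "a \<in> normalisers A mul Z" and T0: "T0_on (gunits G) (dom ` Z)"
  shows "isosection G (dom a)"
proof (rule isosectionI)
  have a: "a \<in> A" and norm: "(\<lambda>w. a \<star> w) ` Z = (\<lambda>w. w \<star> a) ` Z"
    using assms(1) by (auto simp: normalisers_def)
  show dom_a: "dom a \<subseteq> carrier G" using a by (rule dom_carrier)
  have eqI: "u = v" if "u \<in> gunits G" "v \<in> gunits G"
    "\<And>z. z \<in> Z \<Longrightarrow> u \<in> dom z \<longleftrightarrow> v \<in> dom z" for u v
    using T0 that unfolding T0_on_def by blast
  fix g h assume g: "g \<in> dom a" and h: "h \<in> dom a"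
  show "rng G g = rng G h" if src: "src G g = src G h"
  proof (rule eqI)
    fix z assume z: "z \<in> Z"
    then have "z \<star> a \<in> (\<lambda>w. a \<star> w) ` Z" unfolding norm by (rule imageI)
    then obtain w where w: "w \<in> Z" "z \<star> a = a \<star> w" by (rule imageE)
    have "rng G k \<in> dom z \<longleftrightarrow> src G k \<in> dom w" if "k \<in> dom a" for k
      using dom_prod_Z_left[OF a z] dom_prod_Z_right[OF a w(1)] w(2) that
      by (metis (no_types, lifting) mem_Collect_eq)
    from this[OF g] this[OF h] show "rng G g \<in> dom z \<longleftrightarrow> rng G h \<in> dom z"
      using src by simp
  qed (use g h dom_a rng_in_gunits in auto)
  show "src G g = src G h" if rng: "rng G g = rng G h"
  proof (rule eqI)
    fix z assume z: "z \<in> Z"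
    then have "a \<star> z \<in> (\<lambda>w. w \<star> a) ` Z" unfolding norm[symmetric] by (rule imageI)
    then obtain w where w: "w \<in> Z" "a \<star> z = w \<star> a" by (rule imageE)
    have "src G k \<in> dom z \<longleftrightarrow> rng G k \<in> dom w" if "k \<in> dom a" for k
      using dom_prod_Z_right[OF a z] dom_prod_Z_left[OF a w(1)] w(2) that
      by (metis (no_types, lifting) mem_Collect_eq)
    from this[OF g] this[OF h] show "src G g \<in> dom z \<longleftrightarrow> src G h \<in> dom z"
      using rng by simp
  qed (use g h dom_a src_in_gunits in auto)
qed

end

theorem theorem6p5:
  fixes G :: "'g groupoid"
    and T :: "'g topology"
    and A :: "('g \<rightharpoonup> 'y::monoid_mult) set"
    and mul :: "('g \<rightharpoonup> 'y) \<Rightarrow> ('g \<rightharpoonup> 'y) \<Rightarrow> ('g \<rightharpoonup> 'y)"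
  assumes "groupoid G"
    and "topspace T = carrier G"
    and "Hausdorff_space (subtopology T (gunits G))"
    and "one_cancellative TYPE('y)"
    and "A \<subseteq> partial_functions {U. openin T U}"
    and "semigroup_on A mul"
    and "bisection_product G A mul"
    and "T0_on (gunits G) (dom ` Z_of G A)"
  shows "M_of G A mul \<subseteq> normalisers A mul (Z_of G A) \<and>
    normalisers A mul (Z_of G A) \<subseteq> N_of G A"
proof -
  interpret groupoid G by fact
  interpret bisection_semigroup G A mul
  proof
    show "dom a \<subseteq> carrier G" if "a \<in> A" for a
    proof -
      have "openin T (dom a)" using that assms(5) by (auto simp: partial_functions_def)
      then show ?thesis using openin_subset assms(2) by metis
    qed
  qed (fact assms)+
  show ?thesis
    using M_subset_normalisers normaliser_isosection assms(8)
    by (auto simp: N_of_def normalisers_def)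
qed

end
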